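(* Let $R_n(x)=\sum_{k=0}^{n-1} c_n(k)x^k$ for $n\ge 1$. Divisibility below is in $\mathbb{Z}[x]$. (i) If $n=p^k$ with $p$ prime and $k\ge 1$, then $1-x^{p^{k-1}}$ divides $R_n(x)$. (ii) If $n=2^km$ with $k\ge 1$ and $m>1$ odd, then $(1-x^{n/2})(1+x^{n/\gamma(n)})$ divides $R_n(x)$. (iii) If $n=p^km$ with $p>2$ prime, $k\ge 1$, $m>1$ odd and $p\nmid m$, then $1-x^{pn/\gamma(n)}$ divides $R_n(x)$. (iv) If $n=2^km$ with $k\ge 1$, $m>1$ odd having at least two distinct prime divisors, and $p$ is a prime with $p\mid m$, then $(1-x^{n/2})(1+x^{pn/\gamma(n)})$ divides $R_n(x)$.
   Context: For integers $n\ge 1$ and $k$, the Ramanujan sum is $c_n(k)=\sum_{1\le j\le n,\ \gcd(j,n)=1} e^{2\pi i jk/n}$. $\gamma(n)=\prod_{p\mid n}p$ is the product of the distinct primes dividing $n$. *)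

theory Defs
  imports
    Complex_Main
    "HOL-Computational_Algebra.Polynomial"
    "HOL-Computational_Algebra.Primes"
begin

definition ramanujan_sum :: "nat \<Rightarrow> int \<Rightarrow> complex" where
  "ramanujan_sum n k =
     (\<Sum>j | j \<in> {1..n} \<and> gcd j n = 1. exp (2 * of_real pi * \<i> * of_nat j * of_int k / of_nat n))"

text \<open>
  Ramanujan sums are rational integers (\<open>ramanujan_sum_in_Ints\<close> below), so \<open>ramanujan_sum_int n k\<close>
  is the value \<open>c\<^sub>n(k)\<close> regarded as an element of the type of integers.
\<close>
definition ramanujan_sum_int :: "nat \<Rightarrow> int \<Rightarrow> int" where
  "ramanujan_sum_int n k = (THE z. of_int z = ramanujan_sum n k)"

definition ramanujan_poly :: "nat \<Rightarrow> int poly" where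
  "ramanujan_poly n = (\<Sum>k<n. monom (ramanujan_sum_int n (int k)) k)"

definition squarefree_kernel :: "nat \<Rightarrow> nat" where
  "squarefree_kernel n = \<Prod>(prime_factors n)"

lemma sum_ramanujan_sum_divisors:
  assumes "n > 0"
  shows "(\<Sum>d | d dvd n. ramanujan_sum d k) =
         (\<Sum>j\<in>{1..n}. exp (2 * of_real pi * \<i> * of_nat j * of_int k / of_nat n))"
proof -
  have fin: "finite {d. d dvd n}"
    using assms by auto
  have "(\<Sum>d | d dvd n. ramanujan_sum d k) =
        (\<Sum>(d, j) \<in> Sigma {d. d dvd n} (\<lambda>d. {j. j \<in> {1..d} \<and> gcd j d = 1}).
           exp (2 * of_real pi * \<i> * of_nat j * of_int k / of_nat d))"
    unfolding ramanujan_sum_def by (rule sum.Sigma) (use fin in auto)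
  also have "\<dots> = (\<Sum>j\<in>{1..n}. exp (2 * of_real pi * \<i> * of_nat j * of_int k / of_nat n))"
  proof (rule sum.reindex_bij_witness
      [where i = "\<lambda>j. (n div gcd j n, j div gcd j n)" and j = "\<lambda>(d, i). i * (n div d)"])
    fix a assume a: "a \<in> Sigma {d. d dvd n} (\<lambda>d. {j. j \<in> {1..d} \<and> gcd j d = 1})"
    obtain d i where di: "a = (d, i)" "d dvd n" "i \<in> {1..d}" "gcd i d = 1"
      using a by auto
    obtain e where e: "n = d * e" using di by auto
    have pos: "d > 0" "e > 0" using assms e by auto
    have g: "gcd (i * e) (d * e) = e"
      using di by (metis gcd_mult_distrib_nat mult.commute mult_1)
    have nd: "n div d = e" using e pos by simp
    show "(\<lambda>j. (n div gcd j n, j div gcd j n)) ((\<lambda>(d, i). i * (n div d)) a) = a"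
      using g nd pos e di by simp
    show "(\<lambda>(d, i). i * (n div d)) a \<in> {1..n}"
      using nd pos e di by simp
    show "exp (2 * of_real pi * \<i> * of_nat ((\<lambda>(d, i). i * (n div d)) a) * of_int k / of_nat n) =
          (case a of (d, j) \<Rightarrow> exp (2 * of_real pi * \<i> * of_nat j * of_int k / of_nat d))"
      using nd pos e di by (simp add: mult_ac)
  next
    fix j assume j: "j \<in> {1..n}"
    have gp: "gcd j n > 0" using assms by simp
    obtain a where a: "j = gcd j n * a" by (meson gcd_dvd1 dvdE)
    obtain b where b: "n = gcd j n * b" by (meson gcd_dvd2 dvdE)
    have nb: "n div gcd j n = b" by (metis b gp nonzero_mult_div_cancel_left not_gr0)
    have ja: "j div gcd j n = a" by (metis a gp nonzero_mult_div_cancel_left not_gr0)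
    have bpos: "b > 0" using b assms by (metis gr0I mult_0_right)
    have apos: "a > 0" using a j by (metis atLeastAtMost_iff gr0I mult_0_right not_one_le_zero)
    have "a \<le> b" by (metis a b gp j atLeastAtMost_iff mult_le_cancel1)
    moreover have "gcd a b = 1"
      using div_gcd_coprime[of j n] assms nb ja by (simp add: coprime_iff_gcd_eq_1)
    moreover have "b dvd n" using b by (metis dvd_triv_right)
    ultimately show "(n div gcd j n, j div gcd j n) \<in>
        Sigma {d. d dvd n} (\<lambda>d. {j. j \<in> {1..d} \<and> gcd j d = 1})"
      using nb ja apos by auto
    have "n div b = gcd j n" by (metis b bpos nonzero_mult_div_cancel_right not_gr0)
    thus "(\<lambda>(d, i). i * (n div d)) (n div gcd j n, j div gcd j n) = j"
      using nb ja a by (simp add: mult.commute)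
  qed
  finally show ?thesis .
qed

lemma sum_all_exp_in_Ints:
  assumes "n > 0"
  shows "(\<Sum>j\<in>{1..n}. exp (2 * of_real pi * \<i> * of_nat j * of_int k / of_nat n)) \<in> (\<int> :: complex set)"
proof -
  define w :: complex where "w = exp (2 * of_real pi * \<i> * of_int k / of_nat n)"
  have pw: "exp (2 * of_real pi * \<i> * of_nat j * of_int k / of_nat n) = w ^ j" for j
    unfolding w_def exp_of_nat_mult[symmetric] by (simp add: mult_ac)
  have "w ^ n = exp (2 * of_real pi * \<i> * of_int k)"
    using pw[of n] assms by (simp add: mult_ac)
  also have "\<dots> = cis (2 * pi * real_of_int k)"
    by (simp add: cis_conv_exp mult_ac)
  also have "\<dots> = 1" by (rule cis_multiple_2pi) simp
  finally have wn: "w ^ n = 1" .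
  have "(\<Sum>j\<in>{1..n}. w ^ j) \<in> \<int>"
  proof (cases "w = 1")
    case False
    have "(\<Sum>j\<in>{1..n}. w ^ j) = w * (\<Sum>j<n. w ^ j)"
      by (simp add: sum_distrib_left sum.atLeast1_atMost_eq)
    also have "\<dots> = 0" using False wn by (simp add: geometric_sum)
    finally show ?thesis by simp
  qed simp
  thus ?thesis by (simp only: pw)
qed

lemma ramanujan_sum_in_Ints: "ramanujan_sum n k \<in> \<int>"
proof (induction n rule: less_induct)
  case (less n)
  show ?case
  proof (cases "n = 0")
    case True
    thus ?thesis by (simp add: ramanujan_sum_def)
  next
    case False
    have split: "{d. d dvd n} = insert n {d. d dvd n \<and> d < n}"
      using False by (auto dest: dvd_imp_le)
    have "(\<Sum>d | d dvd n. ramanujan_sum d k) =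
          ramanujan_sum n k + (\<Sum>d | d dvd n \<and> d < n. ramanujan_sum d k)"
      unfolding split by (subst sum.insert) auto
    hence "ramanujan_sum n k =
        (\<Sum>d | d dvd n. ramanujan_sum d k) - (\<Sum>d | d dvd n \<and> d < n. ramanujan_sum d k)"
      by simp
    also have "\<dots> \<in> \<int>"
    proof (rule Ints_diff)
      show "(\<Sum>d | d dvd n. ramanujan_sum d k) \<in> \<int>"
        using sum_all_exp_in_Ints[of n k] sum_ramanujan_sum_divisors[of n k] False by simp
      show "(\<Sum>d | d dvd n \<and> d < n. ramanujan_sum d k) \<in> \<int>"
        by (rule Ints_sum) (use less.IH in auto)
    qed
    finally show ?thesis .
  qed
qed

lemma of_int_ramanujan_sum_int: "of_int (ramanujan_sum_int n k) = ramanujan_sum n k"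
proof -
  obtain z where z: "ramanujan_sum n k = of_int z"
    using ramanujan_sum_in_Ints[of n k] by (auto elim: Ints_cases)
  show ?thesis
    unfolding ramanujan_sum_int_def by (rule theI[of _ z]) (auto simp: z)
qed

end

theory Submission
  imports Defs "HOL-Analysis.Complex_Transcendental"
begin

text \<open>
  Orthogonality of the characters \<open>k \<mapsto> exp (2 \<pi> i j k / n)\<close> shows that \<open>R\<^sub>n\<close> vanishes at every
  \<open>n\<close>-th root of unity that is not primitive. Each divisor \<open>f\<close> in the theorem divides
  \<open>1 - x\<^sup>n = f g\<close>, and its roots are non-primitive. Hence \<open>g R\<^sub>n\<close> vanishes at all \<open>n\<close> distinct
  \<open>n\<close>-th roots of unity, so \<open>f g\<close> divides \<open>g R\<^sub>n\<close>; as \<open>x\<^sup>n - 1\<close> is monic, this holds over the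
  integers, and cancelling \<open>g\<close> gives the claim.
\<close>

section \<open>Evaluation of integer polynomials at complex numbers\<close>

definition complex_eval :: "int poly \<Rightarrow> complex \<Rightarrow> complex" where
  "complex_eval p z = poly (map_poly of_int p) z"

lemma complex_eval_0 [simp]: "complex_eval 0 z = 0"
  by (simp add: complex_eval_def)

lemma complex_eval_1 [simp]: "complex_eval 1 z = 1"
  by (simp add: complex_eval_def map_poly_1')

lemma complex_eval_pCons [simp]:
  "complex_eval (pCons a p) z = of_int a + z * complex_eval p z"
  by (simp add: complex_eval_def map_poly_pCons)

lemma complex_eval_monom [simp]: "complex_eval (monom a k) z = of_int a * z ^ k"
  by (simp add: complex_eval_def map_poly_monom poly_monom)

lemma complex_eval_add [simp]:
  "complex_eval (p + q) z = complex_eval p z + complex_eval q z"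
proof (induction p arbitrary: q)
  case (pCons a p)
  obtain b q' where q: "q = pCons b q'" by (rule pCons_cases)
  show ?case unfolding q by (simp add: pCons.IH algebra_simps)
qed simp

lemma complex_eval_uminus [simp]: "complex_eval (- p) z = - complex_eval p z"
  by (induction p) simp_all

lemma complex_eval_diff [simp]:
  "complex_eval (p - q) z = complex_eval p z - complex_eval q z"
  using complex_eval_add[of p "- q" z] by simp

lemma complex_eval_smult [simp]: "complex_eval (smult a p) z = of_int a * complex_eval p z"
  by (induction p) (simp_all add: algebra_simps)

lemma complex_eval_mult [simp]:
  "complex_eval (p * q) z = complex_eval p z * complex_eval q z"
  by (induction p) (simp_all add: algebra_simps)

lemma complex_eval_sum [simp]:
  "complex_eval (\<Sum>i\<in>A. f i) z = (\<Sum>i\<in>A. complex_eval (f i) z)"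
  by (induction A rule: infinite_finite_induct) simp_all

section \<open>Vanishing at roots of unity and divisibility over the integers\<close>

lemma one_minus_monom_dvd_if_vanishes_on_roots_of_unity:
  fixes h :: "int poly"
  assumes "n > 0" and van: "\<And>z. z ^ n = 1 \<Longrightarrow> complex_eval h z = 0"
  shows "1 - monom 1 n dvd h"
proof -
  define u :: "int poly" where "u = monom 1 n - 1"
  have cu: "coeff u n = 1" using \<open>n > 0\<close> by (simp add: u_def)
  have "degree u \<le> n" unfolding u_def
    by (rule degree_diff_le) (simp_all add: degree_monom_le)
  moreover have "n \<le> degree u" using cu by (intro le_degree) simp
  ultimately have du: "degree u = n" by simp
  have "u \<noteq> 0" using cu by auto
  \<comment> \<open>Pseudo-division scales \<open>h\<close> by a power of the leading coefficient of
    \<open>u\<close>. That coefficient is 1, so this is ordinary division with remainder over the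
    integers.\<close>
  obtain q r where qr: "pseudo_divmod h u = (q, r)" by (cases "pseudo_divmod h u")
  have h: "h = u * q + r" and r: "r = 0 \<or> degree r < n"
    using pseudo_divmod[OF \<open>u \<noteq> 0\<close> qr] by (simp_all add: du cu)
  have "r = 0"
  proof (rule ccontr)
    assume "r \<noteq> 0"
    define r' :: "complex poly" where "r' = map_poly of_int r"
    have dr: "degree r' < n"
      using r \<open>r \<noteq> 0\<close> unfolding r'_def by (simp add: degree_map_poly)
    \<comment> \<open>The remainder inherits the zeros of \<open>h\<close> at the \<open>n\<close>
      distinct \<open>n\<close>-th roots of unity, more zeros than its degree allows.\<close>
    have "r' = 0"
    proof (rule poly_eqI_degree[of "{z. z ^ n = 1}"])
      fix z :: complex assume "z \<in> {z. z ^ n = 1}"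
      hence z: "z ^ n = 1" by simp
      have "complex_eval r z = complex_eval h z"
        using z by (simp add: h u_def)
      thus "poly r' z = poly 0 z"
        using van[OF z] by (simp add: r'_def complex_eval_def)
    qed (use dr card_roots_unity_eq[OF \<open>n > 0\<close>] \<open>n > 0\<close> in auto)
    hence "coeff r' k = 0" for k by simp
    hence "r = 0" by (intro poly_eqI) (simp add: r'_def coeff_map_poly)
    thus False using \<open>r \<noteq> 0\<close> by simp
  qed
  hence "u dvd h" using h by simp
  thus ?thesis unfolding u_def by (metis minus_diff_eq minus_dvd_iff)
qed

text \<open>Swapping the sums over \<open>k\<close> and \<open>j\<close> turns the value into a sum
  of geometric sums with ratios \<open>w j * z\<close>, \<open>j\<close> coprime to
  \<open>n\<close>. Each ratio is an \<open>n\<close>-th root of unity, and it is not 1: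
  \<open>w j\<close> is primitive, hence so is its inverse, whereas \<open>z\<close> has order at
  most \<open>d < n\<close>.\<close>

lemma ramanujan_poly_eq_0_if_not_primitive:
  assumes zn: "z ^ n = 1" and zd: "z ^ d = 1" and d: "0 < d" "d < n"
  shows "complex_eval (ramanujan_poly n) z = 0"
proof -
  have "n > 0" using d by simp
  define w where "w j = exp (2 * of_real pi * \<i> * of_nat j / of_nat n)" for j :: nat
  have wk: "exp (2 * of_real pi * \<i> * of_nat j * of_int (int k) / of_nat n) = w j ^ k" for j k
    unfolding w_def exp_of_nat_mult[symmetric] by (simp add: mult_ac)
  have w1: "w j ^ k = 1 \<longleftrightarrow> n dvd j * k" for j k
    using complex_root_unity_eq_1[of n "j * k"] \<open>n > 0\<close> wk[of j k] by (simp add: mult_ac)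
  have zero: "(\<Sum>k<n. (w j * z) ^ k) = 0" if "coprime j n" for j
  proof -
    have "w j * z \<noteq> 1"
    proof
      assume "w j * z = 1"
      hence "w j ^ d * z ^ d = 1" by (metis power_mult_distrib power_one)
      hence "n dvd j * d" using zd w1 by simp
      hence "n dvd d" using that by (simp add: coprime_commute coprime_dvd_mult_right_iff)
      thus False using d by (auto dest: dvd_imp_le)
    qed
    moreover have "(w j * z) ^ n = 1"
      using zn w1[of j n] by (simp add: power_mult_distrib)
    ultimately show ?thesis by (simp add: geometric_sum)
  qed
  have "complex_eval (ramanujan_poly n) z
      = (\<Sum>k<n. (\<Sum>j | j \<in> {1..n} \<and> gcd j n = 1. w j ^ k) * z ^ k)"
    by (simp only: ramanujan_poly_def complex_eval_sum complex_eval_monom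
        of_int_ramanujan_sum_int ramanujan_sum_def wk)
  also have "\<dots> = (\<Sum>k<n. \<Sum>j | j \<in> {1..n} \<and> gcd j n = 1. (w j * z) ^ k)"
    by (simp add: sum_distrib_right power_mult_distrib)
  also have "\<dots> = (\<Sum>j | j \<in> {1..n} \<and> gcd j n = 1. \<Sum>k<n. (w j * z) ^ k)"
    by (rule sum.swap)
  also have "\<dots> = 0"
    by (rule sum.neutral) (auto simp: zero coprime_iff_gcd_eq_1)
  finally show ?thesis .
qed

text \<open>At an \<open>n\<close>-th root of unity either the cofactor \<open>g\<close> vanishes,
  or \<open>f\<close> does; in the latter case \<open>z\<close> is not primitive and the Ramanujan
  polynomial vanishes.\<close>

lemma dvd_ramanujan_poly:
  assumes "n > 0" and f: "f dvd 1 - monom 1 n"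
    and roots: "\<And>z. complex_eval f z = 0 \<Longrightarrow> \<exists>d. 0 < d \<and> d < n \<and> z ^ d = 1"
  shows "f dvd ramanujan_poly n"
proof -
  obtain g where g: "1 - monom 1 n = f * g" using f by auto
  have "complex_eval (g * ramanujan_poly n) z = 0" if z: "z ^ n = 1" for z
  proof -
    have "complex_eval f z * complex_eval g z = 0"
      unfolding complex_eval_mult[symmetric] g[symmetric] using z by simp
    thus ?thesis
      using roots[of z] ramanujan_poly_eq_0_if_not_primitive[OF z] by auto
  qed
  hence "g * f dvd g * ramanujan_poly n"
    using one_minus_monom_dvd_if_vanishes_on_roots_of_unity[OF \<open>n > 0\<close>] g
    by (metis mult.commute)
  \<comment> \<open>Needed to cancel \<open>g\<close>; the product \<open>f * g\<close> has constant
    coefficient 1 because \<open>n > 0\<close>.\<close>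
  moreover have "g \<noteq> 0"
  proof
    assume "g = 0"
    hence "coeff (1 - monom 1 n :: int poly) 0 = 0" using g by simp
    thus False using \<open>n > 0\<close> by simp
  qed
  ultimately show ?thesis by simp
qed

section \<open>Divisors of 1 - x^n without primitive roots\<close>

lemma one_minus_monom_dvd:
  fixes a c :: nat
  shows "(1 :: int poly) - monom 1 a dvd 1 - monom 1 (a * c)"
proof -
  have "(monom 1 a :: int poly) ^ c = monom 1 (a * c)" by (simp add: monom_power)
  thus ?thesis using one_diff_power_eq'[of "monom 1 a :: int poly" c] by (metis dvd_triv_left)
qed

text \<open>This is the factorisation of 1 - y^c at y = -x^b, where odd \<open>c\<close> makes y^c =
  -x^(bc).\<close>

lemma one_plus_monom_dvd_if_odd:
  fixes b c :: nat
  assumes "odd c"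
  shows "(1 :: int poly) + monom 1 b dvd 1 + monom 1 (b * c)"
proof -
  have "(- monom 1 b :: int poly) ^ c = - monom 1 (b * c)"
    using assms by (simp add: power_minus_odd monom_power)
  thus ?thesis using one_diff_power_eq'[of "- monom 1 b :: int poly" c]
    by (metis diff_minus_eq_add dvd_triv_left)
qed

text \<open>The common form of (i) and (iii): every root of the divisor has order at most
  \<open>a\<close>, a proper divisor of \<open>a * c\<close>.\<close>

lemma one_minus_monom_dvd_ramanujan_poly:
  assumes "a > 0" "c > 1"
  shows "1 - monom 1 a dvd ramanujan_poly (a * c)"
proof (rule dvd_ramanujan_poly)
  fix z :: complex assume "complex_eval (1 - monom 1 a) z = 0"
  thus "\<exists>d. 0 < d \<and> d < a * c \<and> z ^ d = 1" using assms by (intro exI[of _ a]) simp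
qed (use assms one_minus_monom_dvd in auto)

text \<open>The common form of (ii) and (iv), with n = 2bc. The second factor divides 1 + x^(bc),
  the cofactor of 1 - x^(bc) in 1 - x^n. Roots have order dividing bc or 2b, and 2b < n since
  \<open>c > 1\<close>.\<close>

lemma two_factors_dvd_ramanujan_poly:
  assumes "b > 0" "c > 1" "odd c"
  shows "(1 - monom 1 (b * c)) * (1 + monom 1 b) dvd ramanujan_poly (2 * (b * c))"
proof (rule dvd_ramanujan_poly)
  have "(1 - monom 1 (b * c) :: int poly) * (1 + monom 1 (b * c)) = 1 - monom 1 (2 * (b * c))"
    unfolding mult_2[of "b * c"] by (simp add: algebra_simps mult_monom)
  thus "(1 - monom 1 (b * c) :: int poly) * (1 + monom 1 b) dvd 1 - monom 1 (2 * (b * c))"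
    using one_plus_monom_dvd_if_odd[OF \<open>odd c\<close>, of b] by (metis mult_dvd_mono dvd_refl)
  fix z :: complex
  assume "complex_eval ((1 - monom 1 (b * c)) * (1 + monom 1 b)) z = 0"
  hence "z ^ (b * c) = 1 \<or> z ^ b = -1" by (auto simp: eq_neg_iff_add_eq_0 add.commute)
  thus "\<exists>d. 0 < d \<and> d < 2 * (b * c) \<and> z ^ d = 1"
  proof
    assume "z ^ (b * c) = 1"
    thus ?thesis using assms by (intro exI[of _ "b * c"]) simp
  next
    assume "z ^ b = -1"
    hence "z ^ (b * 2) = 1" by (simp add: power_mult)
    thus ?thesis using assms by (intro exI[of _ "b * 2"]) simp
  qed
qed (use assms in simp)

section \<open>The squarefree kernel\<close>

lemma squarefree_kernel_dvd:
  assumes "n > 0"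
  shows "squarefree_kernel n dvd n"
proof -
  have "(\<Prod>p\<in>prime_factors n. p) dvd (\<Prod>p\<in>prime_factors n. p ^ multiplicity p n)"
    by (intro prod_dvd_prod dvd_power) (auto simp: prime_factors_multiplicity)
  thus ?thesis
    using prime_factorization_nat[OF assms] by (simp add: squarefree_kernel_def)
qed

lemma squarefree_kernel_gt_1:
  assumes "n > 1"
  shows "squarefree_kernel n > 1"
proof -
  obtain q where q: "prime q" "q dvd n" using assms prime_factor_nat[of n] by auto
  have "q dvd squarefree_kernel n" unfolding squarefree_kernel_def
    by (rule dvd_prodI) (use q assms in \<open>auto simp: in_prime_factors_iff\<close>)
  moreover have "squarefree_kernel n > 0" unfolding squarefree_kernel_def
    by (rule prod_pos) (auto intro: prime_gt_0_nat)
  ultimately show ?thesis using prime_gt_1_nat[OF q(1)] by (meson dvd_imp_le less_le_trans)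
qed

lemma squarefree_kernel_prime_power_mult:
  assumes "prime p" "k \<ge> 1" "m > 0" "\<not> p dvd m"
  shows "squarefree_kernel (p ^ k * m) = p * squarefree_kernel m"
proof -
  have "prime_factors (p ^ k * m) = insert p (prime_factors m)"
    using assms by (auto simp: prime_factors_product prime_factorization_prime_power)
  moreover have "p \<notin> prime_factors m" using assms by auto
  ultimately show ?thesis by (simp add: squarefree_kernel_def)
qed

text \<open>The cofactor \<open>e\<close> is the product of the primes of \<open>m\<close> other
  than \<open>p\<close>; a second prime divisor makes it exceed 1.\<close>

lemma squarefree_kernel_remove_prime:
  assumes "m > 0" "card (prime_factors m) \<ge> 2" "prime p" "p dvd m"
  obtains e where "squarefree_kernel m = p * e" "e > 1"
proof -
  define e where "e = \<Prod>(prime_factors m - {p})"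
  have p: "p \<in> prime_factors m" using assms by (auto simp: in_prime_factors_iff)
  have "card (prime_factors m - {p}) > 0" using p assms by simp
  then obtain q where q: "q \<in> prime_factors m - {p}" by (metis card_gt_0_iff ex_in_conv)
  have "q dvd e" unfolding e_def by (rule dvd_prodI) (use q in auto)
  moreover have "e > 0" unfolding e_def by (rule prod_pos) (auto intro: prime_gt_0_nat)
  moreover have "q > 1" using q prime_gt_1_nat by blast
  ultimately have "e > 1" by (meson dvd_imp_le less_le_trans)
  moreover have "squarefree_kernel m = p * e"
    unfolding squarefree_kernel_def e_def using p by (intro prod.remove) auto
  ultimately show ?thesis using that by blast
qed

theorem theorem7:
  shows "(\<forall>n p k :: nat. prime p \<and> k \<ge> 1 \<and> n = p ^ k \<longrightarrow>
            1 - monom 1 (p ^ (k - 1)) dvd ramanujan_poly n)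
       \<and> (\<forall>n k m :: nat. k \<ge> 1 \<and> m > 1 \<and> odd m \<and> n = 2 ^ k * m \<longrightarrow>
            (1 - monom 1 (n div 2)) * (1 + monom 1 (n div squarefree_kernel n)) dvd ramanujan_poly n)
       \<and> (\<forall>n p k m :: nat. prime p \<and> p > 2 \<and> k \<ge> 1 \<and> m > 1 \<and> odd m \<and> \<not> p dvd m \<and> n = p ^ k * m \<longrightarrow>
            1 - monom 1 (p * n div squarefree_kernel n) dvd ramanujan_poly n)
       \<and> (\<forall>n p k m :: nat. k \<ge> 1 \<and> m > 1 \<and> odd m \<and> card (prime_factors m) \<ge> 2 \<and>
              prime p \<and> p dvd m \<and> n = 2 ^ k * m \<longrightarrow>
            (1 - monom 1 (n div 2)) * (1 + monom 1 (p * n div squarefree_kernel n)) dvd ramanujan_poly n)"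
proof (intro conjI allI impI; elim conjE)
  fix n p k :: nat
  assume *: "prime p" "k \<ge> 1" "n = p ^ k"
  have "n = p ^ (k - 1) * p" using * by (metis Suc_diff_1 Suc_le_eq One_nat_def power_Suc2)
  moreover have "p > 1" using * prime_gt_1_nat by blast
  ultimately show "1 - monom 1 (p ^ (k - 1)) dvd ramanujan_poly n"
    using one_minus_monom_dvd_ramanujan_poly[of "p ^ (k - 1)" p] by simp
next
  fix n k m :: nat
  assume *: "k \<ge> 1" "m > 1" "odd m" "n = 2 ^ k * m"
  \<comment> \<open>The odd part of the kernel of \<open>n\<close> is the exponent ratio
    \<open>c\<close>, and \<open>b\<close> below is \<open>n\<close> divided by its kernel, so that
    n = 2bc.\<close>
  define c where "c = squarefree_kernel m"
  have K: "squarefree_kernel n = 2 * c"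
    using squarefree_kernel_prime_power_mult[of 2 k m] * by (simp add: c_def)
  have "odd c" using squarefree_kernel_dvd[of m] * unfolding c_def by (auto dest: dvd_trans)
  have "c > 1" using squarefree_kernel_gt_1 * by (simp add: c_def)
  obtain b where b: "n = 2 * c * b" using squarefree_kernel_dvd[of n] * K by auto
  have "n > 0" using * by simp
  hence "b > 0" using b by simp
  moreover have "n div squarefree_kernel n = b" using b K \<open>c > 1\<close> by simp
  moreover have "n div 2 = b * c" "n = 2 * (b * c)" using b by simp_all
  ultimately show "(1 - monom 1 (n div 2)) * (1 + monom 1 (n div squarefree_kernel n)) dvd ramanujan_poly n"
    using two_factors_dvd_ramanujan_poly[of b c] \<open>odd c\<close> \<open>c > 1\<close> by metis
next
  fix n p k m :: nat
  assume *: "prime p" "p > 2" "k \<ge> 1" "m > 1" "odd m" "\<not> p dvd m" "n = p ^ k * m"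
  define c where "c = squarefree_kernel m"
  have K: "squarefree_kernel n = p * c"
    using squarefree_kernel_prime_power_mult[of p k m] * by (simp add: c_def)
  have "c > 1" using squarefree_kernel_gt_1 * by (simp add: c_def)
  obtain b where b: "n = p * c * b" using squarefree_kernel_dvd[of n] * K by auto
  have "n > 0" using * by simp
  hence "b > 0" using b by simp
  \<comment> \<open>The kernel of \<open>n\<close> is \<open>p * c\<close>, so the quotient is
    exactly \<open>p * b\<close>, which has index \<open>c > 1\<close> in \<open>n\<close>.\<close>
  have "p * n = (p * b) * (p * c)" using b by simp
  hence "p * n div squarefree_kernel n = p * b"
    using K \<open>p > 2\<close> \<open>c > 1\<close> by simp
  moreover have "n = (p * b) * c" using b by simp
  ultimately show "1 - monom 1 (p * n div squarefree_kernel n) dvd ramanujan_poly n"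
    using one_minus_monom_dvd_ramanujan_poly[of "p * b" c] \<open>b > 0\<close> \<open>c > 1\<close> * by simp
next
  fix n p k m :: nat
  assume *: "k \<ge> 1" "m > 1" "odd m" "card (prime_factors m) \<ge> 2" "prime p" "p dvd m"
    "n = 2 ^ k * m"
  \<comment> \<open>Compared with (ii), the prime \<open>p\<close> moves from the exponent ratio
    into the exponent \<open>p * b\<close>. The ratio left over is \<open>e\<close>, still odd and
    greater than 1.\<close>
  obtain e where e: "squarefree_kernel m = p * e" "e > 1"
    using squarefree_kernel_remove_prime[of m p] * by auto
  have K: "squarefree_kernel n = 2 * (p * e)"
    using squarefree_kernel_prime_power_mult[of 2 k m] * e by simp
  have "e dvd m" using squarefree_kernel_dvd[of m] * e by (auto dest: dvd_mult_right)
  hence "odd e" using * by (auto dest: dvd_trans)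
  obtain b where b: "n = 2 * (p * e) * b" using squarefree_kernel_dvd[of n] * K by auto
  have "n > 0" using * by simp
  hence "b > 0" "p > 0" using b by simp_all
  have "p * n = (p * b) * (2 * (p * e))" using b by simp
  hence "p * n div squarefree_kernel n = p * b"
    using K \<open>p > 0\<close> \<open>e > 1\<close> by simp
  moreover have "n div 2 = (p * b) * e" "n = 2 * ((p * b) * e)" using b by simp_all
  ultimately show "(1 - monom 1 (n div 2)) * (1 + monom 1 (p * n div squarefree_kernel n))
      dvd ramanujan_poly n"
    using two_factors_dvd_ramanujan_poly[of "p * b" e] \<open>b > 0\<close> \<open>p > 0\<close> \<open>e > 1\<close> \<open>odd e\<close>
    by (metis mult_pos_pos)
qed

end
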